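(* Assume that: (i) if $z\in D(j)$ then $j(z+\zeta)=j(z)$ for all $\zeta\in d_N^1:=\{(x,x):x\in\mathbb{R}^N\}$; (ii) $F(n,u)$ is $\omega_i$-periodic ($\omega_i>0$) with respect to each component $u_i$ of $u=(u_1,\dots,u_N)$, $i=1,\dots,N$, for all $n\in\mathbb{Z}[1,T]$. Then, for any $h:\mathbb{Z}[1,T]\to\mathbb{R}^N$ with $\overline{h}=0$, the functional $\mathcal{E}_h$ is bounded from below and attains its infimum at some $u\in D(\Psi+J)$, which is a solution of the problem $$\begin{cases}-\Delta[\phi(\Delta u(n-1))]=\nabla_u F(n,u(n))+h(n) & (n\in\mathbb{Z}[1,T]),\\ (\phi(\Delta u(0)),-\phi(\Delta u(T)))\in\partial j(u(0),u(T+1)).\end{cases}$$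
   Context: $N\ge 1$ and $T\ge 2$ are fixed integers and $a>0$ is fixed. $\langle\cdot|\cdot\rangle$ and $|\cdot|$ are the Euclidean inner product and norm on $\mathbb{R}^N$, and $\mathbb{R}^N\times\mathbb{R}^N$ carries its usual inner product. $B_a=\{x\in\mathbb{R}^N:|x|<a\}$. $\mathbb{Z}[p,q]=\{p,\dots,q\}$. $X_{T+2}=\{u:\mathbb{Z}[0,T+1]\to\mathbb{R}^N\}$. For $h:\mathbb{Z}[1,T]\to\mathbb{R}^N$, $\overline{h}=\frac1T\sum_{k=1}^Th(k)$. $\Delta u(n-1)=u(n)-u(n-1)$, $\Delta[\phi(\Delta u(n-1))]=\phi(\Delta u(n))-\phi(\Delta u(n-1))$, $\|\Delta u\|_\infty=\max_{n\in\mathbb{Z}[1,T+1]}|\Delta u(n-1)|$. Assumptions. (1) $\phi: B_a\to\mathbb{R}^N$ is a homeomorphism from $B_a$ onto $\mathbb{R}^N$ with $\phi(0)=0$ and $\phi=\nabla\Phi$ on $B_a$, where $\Phi:\overline{B}_a\to\mathbb{R}$ is of class $C^1$ on $B_a$, continuous and strictly convex on $\overline{B}_a$, $\Phi(0)=0$. (2) $F=F(n,u):\mathbb{Z}[1,T]\times\mathbb{R}^N\to\mathbb{R}$ is continuous, $\nabla_uF$ exists and is continuous on $\mathbb{Z}[1,T]\times\mathbb{R}^N$, and $F(\cdot,0)=0$. (3) $j:\mathbb{R}^N\times\mathbb{R}^N\to(-\infty,+\infty]$ is proper, convex, lower semicontinuous, $j(0,0)=0$ and $(0,0)\in\partial j(0,0)$,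 where $\partial j$ is the subdifferential in the sense of convex analysis; $D(j)=\{z:j(z)<+\infty\}$. Functionals on $X_{T+2}$: $\Psi(u)=\sum_{n=1}^{T+1}\Phi[\Delta u(n-1)]$ if $\|\Delta u\|_\infty\le a$ and $\Psi(u)=+\infty$ otherwise; $J(u)=j(u(0),u(T+1))$; $\mathcal{E}_h(u)=\Psi(u)+J(u)-\sum_{n=1}^TF(n,u(n))-\sum_{n=1}^T\langle h(n)|u(n)\rangle$. $D(\Psi+J)=\{u\in X_{T+2}:\|\Delta u\|_\infty\le a,\ (u(0),u(T+1))\in D(j)\}$. A solution of the problem is a function $u\in X_{T+2}$ with $\|\Delta u\|_\infty<a$ and $\partial j(u(0),u(T+1))\neq\emptyset$ that satisfies both the equations and the boundary condition. *)

theory Defs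
  imports "HOL-Analysis.Analysis"
begin

section \<open>Convex analysis\<close>

definition strictly_convex_on :: "'a::real_vector set \<Rightarrow> ('a \<Rightarrow> real) \<Rightarrow> bool" where
  "strictly_convex_on S f \<longleftrightarrow> convex S \<and>
     (\<forall>x\<in>S. \<forall>y\<in>S. x \<noteq> y \<longrightarrow>
        (\<forall>t. 0 < t \<and> t < 1 \<longrightarrow>
           f ((1 - t) *\<^sub>R x + t *\<^sub>R y) < (1 - t) * f x + t * f y))"

definition proper_fun :: "('a \<Rightarrow> ereal) \<Rightarrow> bool" where
  "proper_fun f \<longleftrightarrow> (\<forall>x. f x \<noteq> -\<infinity>) \<and> (\<exists>x. f x \<noteq> \<infinity>)"

(* Only used for functions that do not take the value -\<infinity>; at t = 0 and t = 1 the
   inequality is trivial because 0 * \<infinity> = 0 in ereal. *)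
definition convex_efun :: "('a::real_vector \<Rightarrow> ereal) \<Rightarrow> bool" where
  "convex_efun f \<longleftrightarrow>
     (\<forall>x y t. 0 \<le> t \<and> t \<le> 1 \<longrightarrow>
        f ((1 - t) *\<^sub>R x + t *\<^sub>R y) \<le> ereal (1 - t) * f x + ereal t * f y)"

definition lsc_efun :: "('a::topological_space \<Rightarrow> ereal) \<Rightarrow> bool" where
  "lsc_efun f \<longleftrightarrow> (\<forall>x. \<forall>c < f x. \<forall>\<^sub>F y in nhds x. c < f y)"

definition edom :: "('a \<Rightarrow> ereal) \<Rightarrow> 'a set" where
  "edom f = {x. f x < \<infinity>}"

(* For proper f this is empty outside edom f, as usual. *)
definition subdifferential :: "('a::real_inner \<Rightarrow> ereal) \<Rightarrow> 'a \<Rightarrow> 'a set" where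
  "subdifferential f x = {\<xi>. \<forall>y. f x + ereal (inner \<xi> (y - x)) \<le> f y}"

section \<open>The discrete problem\<close>

(* A function on \<int>[0,T+1] is represented by an extensional function on nat, so that
   distinct members of X_space T differ at a point of {0..T+1}. Data given on \<int>[1,T] are
   arbitrary functions on nat, of which only the values on {1..T} are used. *)
definition X_space :: "nat \<Rightarrow> (nat \<Rightarrow> real^'n) set" where
  "X_space T = ({0..T+1} \<rightarrow>\<^sub>E UNIV)"

definition fdiff :: "(nat \<Rightarrow> 'a::ab_group_add) \<Rightarrow> nat \<Rightarrow> 'a" where
  "fdiff u n = u (n + 1) - u n"

definition fdiff_supnorm :: "nat \<Rightarrow> (nat \<Rightarrow> real^'n) \<Rightarrow> real" where
  "fdiff_supnorm T u = Max ((\<lambda>n. norm (fdiff u (n - 1))) ` {1..T+1})"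

definition mean :: "nat \<Rightarrow> (nat \<Rightarrow> real^'n) \<Rightarrow> real^'n" where
  "mean T h = (1 / real T) *\<^sub>R (\<Sum>k=1..T. h k)"

definition Psi :: "real \<Rightarrow> nat \<Rightarrow> (real^'n \<Rightarrow> real) \<Rightarrow> (nat \<Rightarrow> real^'n) \<Rightarrow> ereal" where
  "Psi a T \<Phi> u =
     (if fdiff_supnorm T u \<le> a then ereal (\<Sum>n=1..T+1. \<Phi> (fdiff u (n - 1))) else \<infinity>)"

definition J_fun :: "nat \<Rightarrow> ((real^'n) \<times> (real^'n) \<Rightarrow> ereal) \<Rightarrow> (nat \<Rightarrow> real^'n) \<Rightarrow> ereal" where
  "J_fun T j u = j (u 0, u (T + 1))"

definition energy ::
  "real \<Rightarrow> nat \<Rightarrow> (real^'n \<Rightarrow> real) \<Rightarrow> ((real^'n) \<times> (real^'n) \<Rightarrow> ereal) \<Rightarrow>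
   (nat \<Rightarrow> real^'n \<Rightarrow> real) \<Rightarrow> (nat \<Rightarrow> real^'n) \<Rightarrow> (nat \<Rightarrow> real^'n) \<Rightarrow> ereal" where
  "energy a T \<Phi> j F h u =
     Psi a T \<Phi> u + J_fun T j u - ereal (\<Sum>n=1..T. F n (u n)) - ereal (\<Sum>n=1..T. inner (h n) (u n))"

definition Psi_J_dom ::
  "real \<Rightarrow> nat \<Rightarrow> ((real^'n) \<times> (real^'n) \<Rightarrow> ereal) \<Rightarrow> (nat \<Rightarrow> real^'n) set" where
  "Psi_J_dom a T j =
     {u \<in> X_space T. fdiff_supnorm T u \<le> a \<and> (u 0, u (T + 1)) \<in> edom j}"

(* g n is the gradient of F n. *)
definition is_solution ::
  "real \<Rightarrow> nat \<Rightarrow> (real^'n \<Rightarrow> real^'n) \<Rightarrow> ((real^'n) \<times> (real^'n) \<Rightarrow> ereal) \<Rightarrow>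
   (nat \<Rightarrow> real^'n \<Rightarrow> real^'n) \<Rightarrow> (nat \<Rightarrow> real^'n) \<Rightarrow> (nat \<Rightarrow> real^'n) \<Rightarrow> bool" where
  "is_solution a T \<phi> j g h u \<longleftrightarrow>
     u \<in> X_space T \<and>
     fdiff_supnorm T u < a \<and>
     subdifferential j (u 0, u (T + 1)) \<noteq> {} \<and>
     (\<forall>n\<in>{1..T}. - fdiff (\<lambda>k. \<phi> (fdiff u k)) (n - 1) = g n (u n) + h n) \<and>
     (\<phi> (fdiff u 0), - \<phi> (fdiff u T)) \<in> subdifferential j (u 0, u (T + 1))"

end

theory Submission
  imports Defs
begin

text \<open>
  The solution is found by the direct method. Since \<open>0\<close> is a subgradient of \<open>j\<close> at the origin and
  \<open>j\<close> vanishes there, \<open>j\<close> is nonnegative. Adding to \<open>u\<close> a constant vector made of periods of \<open>F\<close>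
  changes neither the differences of \<open>u\<close>, nor the boundary term, nor the terms with \<open>F\<close>, nor, as
  \<open>h\<close> has mean zero, the linear term. Hence only those \<open>u\<close> matter whose value at \<open>0\<close> lies in a
  period box. Where the energy is finite, consecutive values differ by at most \<open>a\<close>, so these
  competitors form a compact set, on which the lower semicontinuous energy attains its minimum
  (\<open>energy_attains_min\<close>).

  A minimizer is then regular: all its differences lie in the open ball. Indeed \<open>\<phi>\<close> is a
  homeomorphism of the ball onto the whole space, so the gradient of \<open>\<Phi>\<close> blows up at the boundary
  and, by convexity, \<open>\<Phi>\<close> decreases there at infinite slope along the inward radius
  (\<open>radial_steepness\<close>). A minimizer that touches the boundary would thus lose energy when scaled
  towards \<open>0\<close>, which lies in the domain of \<open>j\<close> (\<open>minimizer_interior\<close>).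

  In the interior the energy is the sum of a differentiable function and the convex boundary term.
  Differentiating along segments gives a variational inequality
  (\<open>minimizer_variational_inequality\<close>). Directions that vanish at both end points, and directions
  that vanish at all interior points, turn it into the difference equations and the boundary
  inclusion (\<open>variational_inequality_imp_solution\<close>). This argument works directly with the
  minimizer and needs no existence theory for an auxiliary boundary value problem.
\<close>

section \<open>One-sided difference quotients\<close>

lemma deriv_le_of_right_slope:
  fixes f :: "real \<Rightarrow> real"
  assumes "(f has_real_derivative D) (at 0)"
    and "\<forall>\<^sub>F s in at_right 0. f s - f 0 \<le> c * s"
  shows "D \<le> c"
proof (rule tendsto_upperbound)
  show "((\<lambda>s. (f s - f 0) / s) \<longlongrightarrow> D) (at_right 0)"
    using assms(1) unfolding has_field_derivative_iff
    by (auto intro: filterlim_mono[OF _ order_refl at_le[of _ UNIV]])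
  show "\<forall>\<^sub>F s in at_right 0. (f s - f 0) / s \<le> c"
    using assms(2) eventually_at_right_less[of 0]
    by eventually_elim (simp add: field_simps)
qed simp

lemma GDERIV_line:
  assumes "GDERIV f x :> g"
  shows "((\<lambda>s. f (x + s *\<^sub>R w)) has_real_derivative inner g w) (at 0)"
proof -
  have "(f has_derivative (\<lambda>h. inner h g)) (at (x + 0 *\<^sub>R w))"
    using assms by (simp add: gderiv_def)
  moreover have "((\<lambda>s. x + s *\<^sub>R w) has_derivative (\<lambda>s. s *\<^sub>R w)) (at 0)"
    by (auto intro!: derivative_eq_intros)
  ultimately have "((\<lambda>s. f (x + s *\<^sub>R w)) has_derivative (\<lambda>s. inner (s *\<^sub>R w) g)) (at 0)"
    by (rule has_derivative_compose[rotated])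
  then show ?thesis
    unfolding has_field_derivative_def
    by (rule has_derivative_eq_rhs) (simp add: inner_commute fun_eq_iff)
qed

section \<open>Convex potentials with a singular gradient\<close>

lemma strictly_convex_on_imp_convex_on:
  assumes "strictly_convex_on S f"
  shows "convex_on S f"
proof (rule convex_onI)
  fix t :: real and x y assume "0 < t" "t < 1" "x \<in> S" "y \<in> S"
  then show "f ((1 - t) *\<^sub>R x + t *\<^sub>R y) \<le> (1 - t) * f x + t * f y"
    using assms unfolding strictly_convex_on_def
    by (cases "x = y") (auto simp flip: scaleR_left_distrib distrib_right intro!: less_imp_le)
qed (use assms in \<open>auto simp: strictly_convex_on_def\<close>)

lemma convex_gradient_inequality:
  assumes "convex_on S f" "z \<in> S" "y \<in> S" "GDERIV f z :> g"
  shows "f z + inner g (y - z) \<le> f y"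
proof -
  have "inner g (y - z) \<le> f y - f z"
  proof (rule deriv_le_of_right_slope)
    show "((\<lambda>s. f (z + s *\<^sub>R (y - z))) has_real_derivative inner g (y - z)) (at 0)"
      using assms(4) by (rule GDERIV_line)
    have "\<forall>\<^sub>F s::real in at_right 0. s \<in> {0<..<1}"
      by (rule eventually_at_right_real) simp
    then show "\<forall>\<^sub>F s in at_right 0.
        f (z + s *\<^sub>R (y - z)) - f (z + 0 *\<^sub>R (y - z)) \<le> (f y - f z) * s"
    proof eventually_elim
      case (elim s)
      have "f ((1 - s) *\<^sub>R z + s *\<^sub>R y) \<le> (1 - s) * f z + s * f y"
        using assms elim by (intro convex_onD) auto
      moreover have "(1 - s) *\<^sub>R z + s *\<^sub>R y = z + s *\<^sub>R (y - z)"
        by (simp add: algebra_simps)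
      ultimately show ?case by (simp add: algebra_simps)
    qed
  qed
  then show ?thesis by simp
qed

text \<open>
  Along a filter that converges to a point outside the domain, the norm of a homeomorphism onto the
  whole space tends to infinity, because the preimage of a closed ball is compact, hence closed.
\<close>

lemma homeomorphism_onto_UNIV_blowup:
  fixes \<phi> :: "'a::t2_space \<Rightarrow> 'b::euclidean_space"
  assumes "homeomorphism S UNIV \<phi> \<psi>" "x \<notin> S" "(z \<longlongrightarrow> x) G"
  shows "\<forall>\<^sub>F s in G. z s \<in> S \<longrightarrow> C < norm (\<phi> (z s))"
proof -
  have \<psi>: "continuous_on UNIV \<psi>" "range \<psi> = S" "\<And>y. y \<in> S \<Longrightarrow> \<psi> (\<phi> y) = y"
    using assms(1) by (auto simp: homeomorphism_def)
  have "compact (\<psi> ` cball 0 C)"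
    by (intro compact_continuous_image compact_cball continuous_on_subset[OF \<psi>(1)]) simp
  then have "open (- \<psi> ` cball 0 C)"
    by (simp add: compact_imp_closed open_Compl)
  moreover have "x \<in> - \<psi> ` cball 0 C" using assms(2) \<psi>(2) by auto
  ultimately have "\<forall>\<^sub>F s in G. z s \<in> - \<psi> ` cball 0 C"
    using assms(3) by (rule topological_tendstoD[rotated])
  then show ?thesis
  proof eventually_elim
    case (elim s)
    then show ?case using \<psi>(3)[of "z s"] by (force simp: image_iff not_le)
  qed
qed

text \<open>
  At a boundary point \<open>x\<close> the potential has radial slope \<open>+\<infinity>\<close>, although its values stay finite.
  The gradient inequality between \<open>z = (1 - s) x\<close> and a point \<open>w\<close> of the ball of radius
  \<open>a / 2\<close>, chosen in the direction of the gradient, bounds the inner product of \<open>\<phi> z\<close> and \<open>z\<close> from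
  below by \<open>a / 2 * norm (\<phi> z)\<close> minus a constant, and the norm of \<open>\<phi> z\<close> blows up.
\<close>

lemma radial_steepness:
  fixes \<Phi> :: "'a::euclidean_space \<Rightarrow> real"
  assumes a: "a > 0" and hom: "homeomorphism (ball 0 a) UNIV \<phi> \<psi>"
    and grad: "\<And>x. x \<in> ball 0 a \<Longrightarrow> GDERIV \<Phi> x :> \<phi> x"
    and cont: "continuous_on (cball 0 a) \<Phi>"
    and conv: "convex_on (cball 0 a) \<Phi>"
    and x: "norm x = a"
  shows "\<forall>\<^sub>F s in at_right 0. \<Phi> ((1 - s) *\<^sub>R x) \<le> \<Phi> x - C * s"
proof -
  have "bounded (\<Phi> ` cball 0 a)"
    by (intro compact_imp_bounded compact_continuous_image cont compact_cball)
  then obtain M where M: "\<And>w. w \<in> cball 0 a \<Longrightarrow> \<bar>\<Phi> w\<bar> \<le> M"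
    unfolding bounded_iff by (auto simp del: mem_cball mem_cball_0)
  have "((\<lambda>s. (1 - s) *\<^sub>R x) \<longlongrightarrow> (1 - 0) *\<^sub>R x) (at_right 0)"
    by (intro tendsto_intros)
  then have "\<forall>\<^sub>F s in at_right 0. (1 - s) *\<^sub>R x \<in> ball 0 a \<longrightarrow>
      (\<bar>C\<bar> + 2 * M) / (a / 2) < norm (\<phi> ((1 - s) *\<^sub>R x))"
    by (intro homeomorphism_onto_UNIV_blowup[OF hom]) (use x in auto)
  moreover have "\<forall>\<^sub>F s::real in at_right 0. s \<in> {0<..<1}"
    by (rule eventually_at_right_real) simp
  ultimately show ?thesis
  proof eventually_elim
    case (elim s)
    define z where "z = (1 - s) *\<^sub>R x"
    have z: "z \<in> ball 0 a"
      using elim(2) x a by (simp add: z_def)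
    with elim have big: "\<bar>C\<bar> + 2 * M < a / 2 * norm (\<phi> z)"
      using a by (simp add: z_def field_simps)
    \<comment> \<open>The point of the smaller ball in the direction of the gradient.\<close>
    define w where "w = (a / 2) *\<^sub>R sgn (\<phi> z)"
    have w: "w \<in> cball 0 a"
      using a by (simp add: w_def norm_sgn)
    have "inner (\<phi> z) w = a / 2 * norm (\<phi> z)"
      by (cases "\<phi> z = 0") (simp_all add: w_def sgn_div_norm dot_square_norm power2_eq_square)
    moreover have "\<Phi> z + inner (\<phi> z) (w - z) \<le> \<Phi> w"
      using convex_gradient_inequality[OF conv _ w grad[OF z]] z by simp
    moreover have "\<bar>\<Phi> w\<bar> \<le> M" "\<bar>\<Phi> z\<bar> \<le> M" using M w z by auto
    ultimately have "inner (\<phi> z) z \<ge> \<bar>C\<bar>"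
      using big by (simp add: inner_diff_right)
    then have "\<bar>C\<bar> \<le> (1 - s) * inner (\<phi> z) x" by (simp add: z_def)
    then have "0 \<le> inner (\<phi> z) x" "\<bar>C\<bar> \<le> (1 - s) * inner (\<phi> z) x"
      using elim(2) by (auto simp: zero_le_mult_iff dest: order_trans[OF abs_ge_zero])
    then have "C \<le> inner (\<phi> z) x"
      using elim(2) mult_right_mono[of "1 - s" 1 "inner (\<phi> z) x"] by auto
    then have "C * s \<le> inner (\<phi> z) (x - z)"
      using elim(2) by (simp add: z_def inner_diff_right algebra_simps mult_left_mono)
    moreover have "\<Phi> z + inner (\<phi> z) (x - z) \<le> \<Phi> x"
      using convex_gradient_inequality[OF conv _ _ grad[OF z]] z x by simp
    ultimately show ?case by (simp add: z_def)
  qed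
qed

section \<open>Lower semicontinuous functions\<close>

lemma compact_lsc_attains_min:
  fixes f :: "'a::topological_space \<Rightarrow> 'b::linorder"
  assumes K: "compact K" "K \<noteq> {}"
    and lsc: "\<And>x c. x \<in> K \<Longrightarrow> c < f x \<Longrightarrow> \<forall>\<^sub>F y in at x within K. c < f y"
  shows "\<exists>x\<in>K. \<forall>y\<in>K. f x \<le> f y"
proof (rule ccontr)
  assume "\<not> ?thesis"
  then have "\<forall>x\<in>K. \<exists>y\<in>K. f y < f x" by (auto simp: not_le)
  then obtain m where m: "\<And>x. x \<in> K \<Longrightarrow> m x \<in> K \<and> f (m x) < f x" by metis
  have "\<exists>U. open U \<and> x \<in> U \<and> (\<forall>y\<in>U \<inter> K. f (m x) < f y)" if x: "x \<in> K" for x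
  proof -
    obtain U where "open U" "x \<in> U" "\<forall>y\<in>U. y \<noteq> x \<longrightarrow> y \<in> K \<longrightarrow> f (m x) < f y"
      using lsc[OF x, of "f (m x)"] m[OF x] unfolding eventually_at_topological by blast
    then show ?thesis using m[OF x] by (intro exI[of _ U]) auto
  qed
  then obtain U where U: "\<And>x. x \<in> K \<Longrightarrow> open (U x) \<and> x \<in> U x \<and> (\<forall>y\<in>U x \<inter> K. f (m x) < f y)"
    by metis
  obtain C where C: "C \<subseteq> K" "finite C" "K \<subseteq> (\<Union>x\<in>C. U x)"
    using compactE_image[OF K(1), of K U] U by blast
  have "C \<noteq> {}" using C(3) K(2) by auto
  then obtain x where x: "x \<in> C" "\<And>y. y \<in> C \<Longrightarrow> f (m x) \<le> f (m y)"
    using arg_min_if_finite[OF C(2), of "f \<circ> m"] by (metis comp_apply not_le)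
  then have "m x \<in> K" using C(1) m by auto
  then obtain y where "y \<in> C" "m x \<in> U y" using C(3) by auto
  then have "f (m y) < f (m x)" using U C(1) \<open>m x \<in> K\<close> by auto
  then show False using x(2)[OF \<open>y \<in> C\<close>] by simp
qed

lemma compact_pointwise:
  fixes C :: "'i \<Rightarrow> 'a::topological_space set"
  assumes "\<And>i. compact (C i)"
  shows "compact {u. \<forall>i. u i \<in> C i}"
proof -
  have "compactin (product_topology (\<lambda>_. euclidean) UNIV) (PiE UNIV C)"
    unfolding compactin_PiE using assms by simp
  then show ?thesis
    by (simp add: PiE_UNIV_domain Pi_def euclidean_product_topology compactin_euclidean_iff)
qed

lemma eventually_less_real_plus_lsc:
  fixes p :: "'a \<Rightarrow> real" and q :: "'a \<Rightarrow> ereal"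
  assumes p: "(p \<longlongrightarrow> p0) G" and q: "\<And>d. d < q0 \<Longrightarrow> \<forall>\<^sub>F y in G. d < q y"
    and c: "c < ereal p0 + q0" and q0: "q0 \<noteq> -\<infinity>"
  shows "\<forall>\<^sub>F y in G. c < ereal (p y) + q y"
proof -
  obtain c' where c': "c < ereal c'" "ereal c' < ereal p0 + q0"
    using ereal_dense2[OF c] by auto
  then have "ereal (c' - p0) < q0"
    by (cases q0) auto
  then obtain d where d: "ereal (c' - p0) < ereal d" "ereal d < q0"
    using ereal_dense2 by blast
  have "\<forall>\<^sub>F y in G. c' - d < p y"
    using d(1) by (intro order_tendstoD(1)[OF p]) simp
  moreover have "\<forall>\<^sub>F y in G. ereal d < q y" by (rule q[OF d(2)])
  ultimately show ?thesis
  proof eventually_elim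
    case (elim y)
    then have "ereal c' \<le> ereal (p y) + q y"
      by (cases "q y") auto
    then show ?case using c'(1) by simp
  qed
qed

section \<open>The energy as a smooth action plus a convex boundary term\<close>

text \<open>
  The terms of the energy that contain \<open>F\<close> and \<open>h\<close>, with reversed sign.
\<close>

definition load :: "nat \<Rightarrow> (nat \<Rightarrow> 'a::real_inner \<Rightarrow> real) \<Rightarrow> (nat \<Rightarrow> 'a) \<Rightarrow> (nat \<Rightarrow> 'a) \<Rightarrow> real" where
  "load T F h u = (\<Sum>n=1..T. F n (u n) + inner (h n) (u n))"

text \<open>
  The energy without the boundary term. Differences are indexed by their left end point, so the
  index runs over \<open>0, \<dots>, T\<close>. No constraint on the differences is built in: the value is
  meaningful only if all of them lie in the domain of \<open>\<Phi>\<close>.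
\<close>

definition action ::
  "nat \<Rightarrow> ('a::real_inner \<Rightarrow> real) \<Rightarrow> (nat \<Rightarrow> 'a \<Rightarrow> real) \<Rightarrow> (nat \<Rightarrow> 'a) \<Rightarrow> (nat \<Rightarrow> 'a) \<Rightarrow> real" where
  "action T \<Phi> F h u = (\<Sum>k\<le>T. \<Phi> (fdiff u k)) - load T F h u"

lemma image_shifted_differences: "(\<lambda>n. f (n - 1)) ` {1..T+1} = f ` {..T}" for f :: "nat \<Rightarrow> 'b"
proof -
  have "{1..T+1} = Suc ` {..T}"
    by (simp add: image_Suc_atMost)
  then show ?thesis by (simp only: image_image diff_Suc_1)
qed

lemma fdiff_supnorm_eq: "fdiff_supnorm T u = Max ((\<lambda>k. norm (fdiff u k)) ` {..T})"
  unfolding fdiff_supnorm_def image_shifted_differences[of "\<lambda>k. norm (fdiff u k)"] ..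

lemma fdiff_supnorm_le_iff: "fdiff_supnorm T u \<le> a \<longleftrightarrow> (\<forall>k\<le>T. norm (fdiff u k) \<le> a)"
  by (subst fdiff_supnorm_eq, subst Max_le_iff) auto

lemma fdiff_supnorm_less_iff: "fdiff_supnorm T u < a \<longleftrightarrow> (\<forall>k\<le>T. norm (fdiff u k) < a)"
  by (subst fdiff_supnorm_eq, subst Max_less_iff) auto

lemma Psi_eq:
  "Psi a T \<Phi> u =
     (if \<forall>k\<le>T. norm (fdiff u k) \<le> a then ereal (\<Sum>k\<le>T. \<Phi> (fdiff u k)) else \<infinity>)"
proof -
  have "(\<Sum>n=1..T+1. \<Phi> (fdiff u (n - 1))) = (\<Sum>k\<le>T. \<Phi> (fdiff u k))"
    by (rule sum.reindex_bij_witness[of _ Suc "\<lambda>n. n - 1"]) auto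
  then show ?thesis
    by (simp add: Psi_def fdiff_supnorm_le_iff)
qed

lemma energy_eq:
  assumes "j (u 0, u (T + 1)) \<noteq> -\<infinity>"
  shows "energy a T \<Phi> j F h u =
     (if \<forall>k\<le>T. norm (fdiff u k) \<le> a
      then ereal (action T \<Phi> F h u) + j (u 0, u (T + 1)) else \<infinity>)"
  using assms unfolding energy_def Psi_eq J_fun_def action_def load_def sum.distrib
  by (cases "j (u 0, u (T + 1))") auto

text \<open>
  The energy depends only on the values on \<open>{0..T+1}\<close>, so competitors need not be extensional.
\<close>

lemma energy_restrict: "energy a T \<Phi> j F h (restrict u {0..T+1}) = energy a T \<Phi> j F h u"
proof -
  have "fdiff_supnorm T (restrict u {0..T+1}) = fdiff_supnorm T u"
    unfolding fdiff_supnorm_eq by (intro arg_cong[where f = Max] image_cong) (auto simp: fdiff_def)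
  moreover have "(\<Sum>n=1..T+1. \<Phi> (fdiff (restrict u {0..T+1}) (n - 1)))
      = (\<Sum>n=1..T+1. \<Phi> (fdiff u (n - 1)))"
    by (intro sum.cong) (auto simp: fdiff_def)
  moreover have "(\<Sum>n=1..T. F n (restrict u {0..T+1} n)) = (\<Sum>n=1..T. F n (u n))"
    "(\<Sum>n=1..T. inner (h n) (restrict u {0..T+1} n)) = (\<Sum>n=1..T. inner (h n) (u n))"
    by (intro sum.cong; auto)+
  ultimately show ?thesis
    by (simp add: energy_def Psi_def J_fun_def)
qed

lemma convex_efunD:
  "convex_efun f \<Longrightarrow> 0 \<le> t \<Longrightarrow> t \<le> 1 \<Longrightarrow>
     f ((1 - t) *\<^sub>R x + t *\<^sub>R y) \<le> ereal (1 - t) * f x + ereal t * f y"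
  by (simp add: convex_efun_def)

lemma fdiff_line: "fdiff (\<lambda>n. u n + s *\<^sub>R w n) k = fdiff u k + s *\<^sub>R fdiff w k"
  for u :: "nat \<Rightarrow> 'a::real_vector"
  by (simp add: fdiff_def algebra_simps)

lemma load_has_line_derivative:
  assumes "\<And>n. n \<in> {1..T} \<Longrightarrow> GDERIV (F n) (u n) :> g n"
  shows "((\<lambda>s. load T F h (\<lambda>n. u n + s *\<^sub>R w n)) has_real_derivative
           (\<Sum>n=1..T. inner (g n + h n) (w n))) (at 0)"
proof -
  have "((\<lambda>s. F n (u n + s *\<^sub>R w n) + inner (h n) (u n + s *\<^sub>R w n)) has_real_derivative
          inner (g n + h n) (w n)) (at 0)" if "n \<in> {1..T}" for n
  proof -
    have "((\<lambda>s. inner (h n) (u n + s *\<^sub>R w n)) has_real_derivative inner (h n) (w n)) (at 0)"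
      unfolding inner_add_right inner_scaleR_right by (auto intro!: derivative_eq_intros)
    with GDERIV_line[OF assms[OF that]] show ?thesis
      unfolding inner_add_left by (rule DERIV_add)
  qed
  then show ?thesis unfolding load_def by (intro DERIV_sum)
qed

lemma action_has_line_derivative:
  assumes "\<And>k. k \<le> T \<Longrightarrow> GDERIV \<Phi> (fdiff u k) :> p k"
    and "\<And>n. n \<in> {1..T} \<Longrightarrow> GDERIV (F n) (u n) :> g n"
  shows "((\<lambda>s. action T \<Phi> F h (\<lambda>n. u n + s *\<^sub>R w n)) has_real_derivative
           (\<Sum>k\<le>T. inner (p k) (fdiff w k)) - (\<Sum>n=1..T. inner (g n + h n) (w n))) (at 0)"
  unfolding action_def fdiff_line
  by (intro DERIV_diff DERIV_sum GDERIV_line load_has_line_derivative assms) auto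

section \<open>Regularity of minimizers and the Euler-Lagrange equations\<close>

text \<open>
  A minimizer cannot touch the constraint. If the \<open>m\<close>-th difference had norm \<open>a\<close>, then \<open>(1 - s) u\<close>
  would have smaller energy for small \<open>s > 0\<close>: the load changes at a finite rate \<open>L\<close>, neither
  \<open>j\<close> nor any other summand of the potential energy increases, and the \<open>m\<close>-th summand decreases
  faster than any linear function of \<open>s\<close>.
\<close>

lemma minimizer_interior:
  fixes \<Phi> :: "'a::euclidean_space \<Rightarrow> real"
  assumes a: "a > 0" and hom: "homeomorphism (ball 0 a) UNIV \<phi> \<psi>"
    and grad: "\<And>x. x \<in> ball 0 a \<Longrightarrow> GDERIV \<Phi> x :> \<phi> x"
    and cont: "continuous_on (cball 0 a) \<Phi>"
    and conv: "convex_on (cball 0 a) \<Phi>"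
    and \<Phi>0: "\<Phi> 0 = 0" and \<phi>0: "\<phi> 0 = 0"
    and F: "\<And>n. n \<in> {1..T} \<Longrightarrow> GDERIV (F n) (u n) :> g n"
    and j: "convex_efun j" "j (0, 0) = 0" "\<And>z. 0 \<le> j z"
    and fin: "j (u 0, u (T + 1)) \<noteq> \<infinity>"
    and u: "\<And>k. k \<le> T \<Longrightarrow> norm (fdiff u k) \<le> a"
    and min: "\<And>v. (\<And>k. k \<le> T \<Longrightarrow> norm (fdiff v k) \<le> a) \<Longrightarrow>
      ereal (action T \<Phi> F h u) + j (u 0, u (T + 1)) \<le> ereal (action T \<Phi> F h v) + j (v 0, v (T + 1))"
    and m: "m \<le> T"
  shows "norm (fdiff u m) < a"
proof (rule ccontr)
  assume "\<not> norm (fdiff u m) < a"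
  with u[OF m] have um: "norm (fdiff u m) = a" by simp
  define L where "L = (\<Sum>n=1..T. inner (g n + h n) (- u n))"
  \<comment> \<open>The tangent to \<open>\<Phi>\<close> at the origin is zero.\<close>
  have nonneg: "0 \<le> \<Phi> x" if "x \<in> cball 0 a" for x
    using convex_gradient_inequality[OF conv _ that grad[of 0]] a \<Phi>0 \<phi>0 by simp
  have shrink: "\<Phi> ((1 - s) *\<^sub>R x) \<le> \<Phi> x" if "x \<in> cball 0 a" "s \<in> {0<..<1}" for s x
  proof -
    have "\<Phi> ((1 - s) *\<^sub>R x + s *\<^sub>R 0) \<le> (1 - s) * \<Phi> x + s * \<Phi> 0"
      using that a by (intro convex_onD[OF conv]) auto
    also have "\<dots> \<le> \<Phi> x"
      using \<Phi>0 nonneg[OF that(1)] that(2) by (simp add: algebra_simps)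
    finally show ?thesis by simp
  qed
  have steep: "\<forall>\<^sub>F s in at_right 0. \<Phi> ((1 - s) *\<^sub>R fdiff u m) \<le> \<Phi> (fdiff u m) - (1 - L) * s"
    by (rule radial_steepness[OF a hom grad cont conv um])
  have "((\<lambda>s. load T F h (\<lambda>n. u n + s *\<^sub>R - u n)) has_real_derivative L) (at 0)"
    unfolding L_def by (intro load_has_line_derivative F)
  \<comment> \<open>The sum with \<open>\<Phi>\<close> drops by at least \<open>(1 - L) s\<close>, so by minimality the load drops as much.
    Its derivative \<open>L\<close> would then be at most \<open>L - 1\<close>.\<close>
  moreover have "\<forall>\<^sub>F s in at_right 0. load T F h (\<lambda>n. u n + s *\<^sub>R - u n)
      - load T F h (\<lambda>n. u n + 0 *\<^sub>R - u n) \<le> (L - 1) * s"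
    using steep eventually_at_right_real[of 0 1, OF zero_less_one]
  proof eventually_elim
    case (elim s)
    define v where "v n = u n + s *\<^sub>R - u n" for n
    have v: "v n = (1 - s) *\<^sub>R u n" for n by (simp add: v_def algebra_simps)
    have fv: "fdiff v k = (1 - s) *\<^sub>R fdiff u k" for k
      by (simp add: fdiff_def v algebra_simps)
    have "norm (fdiff v k) \<le> a" if "k \<le> T" for k
      using mult_mono[of "1 - s" 1 "norm (fdiff u k)" a] u[OF that] elim(2) by (simp add: fv)
    then have le: "ereal (action T \<Phi> F h u) + j (u 0, u (T + 1)) \<le>
        ereal (action T \<Phi> F h v) + j (v 0, v (T + 1))"
      by (rule min)
    have "j (v 0, v (T + 1)) = j ((1 - s) *\<^sub>R (u 0, u (T + 1)) + s *\<^sub>R (0, 0))"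
      by (simp add: v)
    also have "\<dots> \<le> ereal (1 - s) * j (u 0, u (T + 1)) + ereal s * j (0, 0)"
      by (rule convex_efunD[OF j(1)]) (use elim(2) in auto)
    also have "\<dots> \<le> j (u 0, u (T + 1))"
      using j(2) j(3)[of "(u 0, u (T + 1))"] fin elim(2)
      by (cases "j (u 0, u (T + 1))") (auto simp: mult_left_le_one_le)
    finally have jle: "j (v 0, v (T + 1)) \<le> j (u 0, u (T + 1))" .
    then have "action T \<Phi> F h u \<le> action T \<Phi> F h v"
      using le j(3)[of "(u 0, u (T + 1))"] fin j(3)[of "(v 0, v (T + 1))"]
      by (cases "j (u 0, u (T + 1))"; cases "j (v 0, v (T + 1))") auto
    moreover have "(\<Sum>k\<le>T. \<Phi> (fdiff v k)) \<le> (\<Sum>k\<le>T. \<Phi> (fdiff u k)) - (1 - L) * s"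
    proof -
      have "(\<Sum>k\<in>{..T}-{m}. \<Phi> (fdiff v k)) \<le> (\<Sum>k\<in>{..T}-{m}. \<Phi> (fdiff u k))"
        using u elim(2) by (intro sum_mono) (auto simp: fv intro!: shrink)
      moreover have "\<Phi> (fdiff v m) \<le> \<Phi> (fdiff u m) - (1 - L) * s"
        using elim(1) by (simp add: fv)
      ultimately show ?thesis using m by (simp add: sum.remove[of "{..T}" m])
    qed
    ultimately have "load T F h v - load T F h u \<le> (L - 1) * s"
      by (simp add: action_def algebra_simps)
    then show ?case by (simp add: v_def[abs_def])
  qed
  ultimately have "L \<le> L - 1" by (rule deriv_le_of_right_slope)
  then show False by simp
qed

text \<open>
  The boundary term need not be differentiable; convexity replaces its increment from \<open>u\<close> to
  \<open>u + s w\<close> by \<open>s\<close> times its increment from \<open>u\<close> to \<open>u + w\<close>. The direction \<open>w\<close> is restricted only by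
  finiteness of \<open>j\<close>, since all differences of \<open>u\<close> lie in the open ball.
\<close>

lemma minimizer_variational_inequality:
  fixes \<Phi> :: "'a::euclidean_space \<Rightarrow> real"
  assumes grad: "\<And>x. x \<in> ball 0 a \<Longrightarrow> GDERIV \<Phi> x :> \<phi> x"
    and F: "\<And>n. n \<in> {1..T} \<Longrightarrow> GDERIV (F n) (u n) :> g n"
    and j: "convex_efun j" "j (u 0, u (T + 1)) = ereal ju"
    and u: "\<And>k. k \<le> T \<Longrightarrow> norm (fdiff u k) < a"
    and min: "\<And>v. (\<And>k. k \<le> T \<Longrightarrow> norm (fdiff v k) \<le> a) \<Longrightarrow>
      ereal (action T \<Phi> F h u) + j (u 0, u (T + 1)) \<le> ereal (action T \<Phi> F h v) + j (v 0, v (T + 1))"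
    and jw: "j (u 0 + w 0, u (T + 1) + w (T + 1)) = ereal jw"
  shows "ju + (\<Sum>n=1..T. inner (g n + h n) (w n)) \<le> jw + (\<Sum>k\<le>T. inner (\<phi> (fdiff u k)) (fdiff w k))"
proof -
  let ?D = "(\<Sum>k\<le>T. inner (\<phi> (fdiff u k)) (fdiff w k)) - (\<Sum>n=1..T. inner (g n + h n) (w n))"
  have "((\<lambda>s. action T \<Phi> F h (\<lambda>n. u n + s *\<^sub>R w n)) has_real_derivative ?D) (at 0)"
    using u by (intro action_has_line_derivative grad F) auto
  then have "((\<lambda>s. - action T \<Phi> F h (\<lambda>n. u n + s *\<^sub>R w n)) has_real_derivative - ?D) (at 0)"
    by (rule DERIV_minus)
  moreover have "\<forall>\<^sub>F s in at_right 0. - action T \<Phi> F h (\<lambda>n. u n + s *\<^sub>R w n)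
      - - action T \<Phi> F h (\<lambda>n. u n + 0 *\<^sub>R w n) \<le> (jw - ju) * s"
  proof -
    have "\<forall>\<^sub>F s in at_right 0. \<forall>k\<in>{..T}. norm (fdiff u k + s *\<^sub>R fdiff w k) < a"
    proof (intro eventually_ball_finite ballI)
      fix k assume "k \<in> {..T}"
      have "((\<lambda>s. norm (fdiff u k + s *\<^sub>R fdiff w k)) \<longlongrightarrow> norm (fdiff u k + 0 *\<^sub>R fdiff w k)) (at_right 0)"
        by (intro tendsto_intros)
      then show "\<forall>\<^sub>F s in at_right 0. norm (fdiff u k + s *\<^sub>R fdiff w k) < a"
        by (rule order_tendstoD) (use u \<open>k \<in> {..T}\<close> in auto)
    qed simp
    with eventually_at_right_real[of 0 1, OF zero_less_one] show ?thesis
    proof eventually_elim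
      case (elim s)
      define v where "v n = u n + s *\<^sub>R w n" for n
      have "norm (fdiff v k) \<le> a" if "k \<le> T" for k
        using elim(2) that by (auto simp: v_def[abs_def] fdiff_line intro: less_imp_le)
      then have le: "ereal (action T \<Phi> F h u) + j (u 0, u (T + 1)) \<le>
          ereal (action T \<Phi> F h v) + j (v 0, v (T + 1))"
        by (rule min)
      have "j (v 0, v (T + 1)) = j ((1 - s) *\<^sub>R (u 0, u (T + 1)) + s *\<^sub>R (u 0 + w 0, u (T + 1) + w (T + 1)))"
        by (simp add: v_def algebra_simps)
      also have "\<dots> \<le> ereal (1 - s) * j (u 0, u (T + 1)) + ereal s * j (u 0 + w 0, u (T + 1) + w (T + 1))"
        by (rule convex_efunD[OF j(1)]) (use elim(1) in auto)
      finally have "j (v 0, v (T + 1)) \<le> ereal ((1 - s) * ju + s * jw)"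
        using j(2) jw by simp
      then have "action T \<Phi> F h u + ju \<le> action T \<Phi> F h v + ((1 - s) * ju + s * jw)"
        using le j(2) by (cases "j (v 0, v (T + 1))") auto
      then show ?case by (simp add: v_def[symmetric] algebra_simps)
    qed
  qed
  ultimately have "- ?D \<le> jw - ju" by (rule deriv_le_of_right_slope)
  then show ?thesis by simp
qed

text \<open>
  After summation by parts, directions supported at one interior point give the equations, and
  directions supported at the end points \<open>0\<close> and \<open>T + 1\<close> give the boundary condition.
\<close>

lemma variational_inequality_imp_solution:
  fixes p :: "nat \<Rightarrow> 'a::real_inner"
  assumes T: "T \<ge> 1" and ju: "j (u 0, u (T + 1)) = ereal ju" and jm: "\<And>z. j z \<noteq> -\<infinity>"
    and var: "\<And>w jw. j (u 0 + w 0, u (T + 1) + w (T + 1)) = ereal jw \<Longrightarrow>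
      ju + (\<Sum>n=1..T. inner (f n) (w n)) \<le> jw + (\<Sum>k\<le>T. inner (p k) (fdiff w k))"
  shows "\<And>n. n \<in> {1..T} \<Longrightarrow> p (n - 1) - p n = f n"
    and "(p 0, - p T) \<in> subdifferential j (u 0, u (T + 1))"
proof -
  have parts: "(\<Sum>k\<le>T. inner (p k) (fdiff w k)) =
      inner (p T) (w (T + 1)) - inner (p 0) (w 0) + (\<Sum>n=1..T. inner (p (n - 1) - p n) (w n))" for w
  proof (induction T)
    case (Suc t)
    then show ?case by (simp add: fdiff_def algebra_simps)
  qed (simp add: fdiff_def inner_diff_right)
  show "p (n - 1) - p n = f n" if n: "n \<in> {1..T}" for n
  proof -
    let ?d = "p (n - 1) - p n - f n"
    \<comment> \<open>Testing with the negative residual at the single point \<open>n\<close>.\<close>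
    define w where "w k = (if k = n then - ?d else 0)" for k
    have "w 0 = 0" "w (T + 1) = 0" using n by (auto simp: w_def)
    with var[of w ju] ju have "(\<Sum>k=1..T. inner (f k) (w k)) \<le> (\<Sum>k=1..T. inner (p (k - 1) - p k) (w k))"
      by (simp add: parts)
    moreover have "(\<Sum>k=1..T. inner (q k) (w k)) = inner (q n) (- ?d)" for q
      using n sum.delta[of "{1..T}" n "\<lambda>k. inner (q k) (- ?d)"]
      by (simp add: w_def if_distrib[of "inner _"] cong: if_cong)
    ultimately have "inner (f n) (- ?d) \<le> inner (p (n - 1) - p n) (- ?d)" by simp
    then have "inner ?d ?d \<le> 0" by (simp only: inner_diff_left inner_minus_right)
    then show ?thesis by (simp add: inner_gt_zero_iff flip: not_less)
  qed
  have "j (u 0, u (T + 1)) + ereal (inner (p 0, - p T) (y - (u 0, u (T + 1)))) \<le> j y" for y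
  proof (cases "j y")
    case (real jw)
    define w where "w n = (if n = 0 then fst y - u 0 else if n = T + 1 then snd y - u (T + 1) else 0)" for n
    have w0: "(\<Sum>n=1..T. inner (q n) (w n)) = 0" for q
      by (intro sum.neutral) (auto simp: w_def)
    have "ju \<le> jw + inner (p T) (w (T + 1)) - inner (p 0) (w 0)"
      using var[of w jw] real unfolding parts w0 by (simp add: w_def)
    then show ?thesis
      using real ju by (simp add: w_def inner_prod_def algebra_simps)
  qed (use jm in auto)
  then show "(p 0, - p T) \<in> subdifferential j (u 0, u (T + 1))"
    unfolding subdifferential_def by blast
qed

section \<open>Translation by periods\<close>

lemma period_of_int:
  fixes f :: "'a::real_vector \<Rightarrow> 'b"
  assumes "\<And>x. f (x + p) = f x"
  shows "f (x + of_int m *\<^sub>R p) = f x"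
proof -
  have nat: "f (x + of_nat n *\<^sub>R p) = f x" for n x
  proof (induction n)
    case (Suc n)
    have "f (x + of_nat (Suc n) *\<^sub>R p) = f ((x + of_nat n *\<^sub>R p) + p)"
      by (simp add: algebra_simps)
    then show ?case using assms Suc by simp
  qed simp
  show ?thesis
  proof (cases m rule: int_cases2)
    case (nonpos n)
    then show ?thesis using nat[of "x + of_int m *\<^sub>R p" n] by simp
  qed (simp add: nat)
qed

lemma period_lattice:
  fixes f :: "'a::real_vector \<Rightarrow> 'b" and m :: "'i \<Rightarrow> int"
  assumes "finite I" "\<And>x i. i \<in> I \<Longrightarrow> f (x + p i) = f x"
  shows "f (x + (\<Sum>i\<in>I. of_int (m i) *\<^sub>R p i)) = f x"
  using assms
proof (induction I arbitrary: x)
  case (insert i I)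
  have "f (x + (\<Sum>i\<in>insert i I. of_int (m i) *\<^sub>R p i)) =
      f ((x + of_int (m i) *\<^sub>R p i) + (\<Sum>i\<in>I. of_int (m i) *\<^sub>R p i))"
    using insert.hyps by (simp add: add.assoc)
  also have "\<dots> = f (x + of_int (m i) *\<^sub>R p i)"
    by (rule insert.IH) (simp add: insert.prems)
  also have "\<dots> = f x"
    by (rule period_of_int) (simp add: insert.prems)
  finally show ?case .
qed simp

lemma lattice_translate_into_box:
  fixes x :: "real^'n" and \<omega> :: "'n \<Rightarrow> real"
  assumes "\<And>i. \<omega> i > 0"
  shows "norm (x + (\<Sum>i\<in>UNIV. of_int (- \<lfloor>x $ i / \<omega> i\<rfloor>) *\<^sub>R (\<omega> i *\<^sub>R axis i 1))) \<le> (\<Sum>i\<in>UNIV. \<omega> i)"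
    (is "norm ?y \<le> _")
proof -
  have "\<bar>?y $ i\<bar> \<le> \<omega> i" for i
  proof -
    have "?y $ i = x $ i - of_int \<lfloor>x $ i / \<omega> i\<rfloor> * \<omega> i"
      by (simp add: axis_def if_distrib[of "(*) _"] sum_negf cong: if_cong)
    also have "\<dots> = frac (x $ i / \<omega> i) * \<omega> i"
      using assms[of i] by (simp add: frac_def field_simps)
    finally show ?thesis
      using assms[of i] frac_ge_0[of "x $ i / \<omega> i"] frac_lt_1[of "x $ i / \<omega> i"]
      by (simp add: abs_mult)
  qed
  then show ?thesis
    by (intro order_trans[OF norm_le_l1_cart] sum_mono)
qed

lemma action_translate:
  assumes "(\<Sum>n=1..T. h n) = 0" "\<And>n x. n \<in> {1..T} \<Longrightarrow> F n (x + c) = F n x"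
  shows "action T \<Phi> F h (\<lambda>n. u n + c) = action T \<Phi> F h u"
proof -
  have "(\<Sum>n=1..T. inner (h n) c) = 0"
    using assms(1) by (simp flip: inner_sum_left)
  then show ?thesis
    using assms(2) by (simp add: action_def load_def fdiff_def inner_add_right sum.distrib)
qed

section \<open>Existence of a minimizer\<close>

lemma norm_le_of_differences:
  fixes u :: "nat \<Rightarrow> 'a::real_normed_vector"
  assumes "\<And>k. k < n \<Longrightarrow> norm (fdiff u k) \<le> a"
  shows "norm (u n) \<le> norm (u 0) + real n * a"
  using assms
proof (induction n)
  case (Suc n)
  have "norm (u (Suc n)) \<le> norm (u n) + norm (fdiff u n)"
    using norm_triangle_ineq[of "u n" "fdiff u n"] by (simp add: fdiff_def)
  moreover have "norm (u n) \<le> norm (u 0) + real n * a"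
    using Suc.prems by (intro Suc.IH) simp
  ultimately show ?case using Suc.prems[of n] by (simp add: algebra_simps)
qed simp

lemma continuous_on_action:
  fixes \<Phi> :: "'a::real_inner \<Rightarrow> real"
  assumes "continuous_on (cball 0 a) \<Phi>"
    and "\<And>n. n \<in> {1..T} \<Longrightarrow> continuous_on UNIV (F n)"
    and "\<And>u k. u \<in> K \<Longrightarrow> k \<le> T \<Longrightarrow> norm (fdiff u k) \<le> a"
  shows "continuous_on K (action T \<Phi> F h)"
proof -
  have coord: "continuous_on K (\<lambda>u. u i)" for i
    by (rule continuous_on_subset[OF continuous_on_product_coordinates]) simp
  show ?thesis
    unfolding action_def load_def fdiff_def
    by (intro continuous_intros coord continuous_on_compose2[OF assms(1)] continuous_on_compose2[OF assms(2)])
      (use assms(3) in \<open>auto simp: fdiff_def\<close>)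
qed

text \<open>
  Translation by a vector of periods leaves the energy unchanged, so \<open>u 0\<close> may be assumed to lie in
  the period box; the bound on the differences then confines all values of \<open>u\<close> to a ball. The
  competitors that remain form a compact set \<open>K \<inter> A\<close> in the product topology, on which the energy
  is lower semicontinuous. The values of members of \<open>K\<close> outside \<open>{0..T+1}\<close> are \<open>undefined\<close>, which
  makes them extensional.
\<close>

lemma energy_attains_min:
  fixes \<Phi> :: "real^'n \<Rightarrow> real" and j :: "(real^'n) \<times> (real^'n) \<Rightarrow> ereal"
  assumes a: "a \<ge> 0"
    and \<Phi>: "continuous_on (cball 0 a) \<Phi>"
    and F: "\<And>n. n \<in> {1..T} \<Longrightarrow> continuous_on UNIV (F n)"
    and j: "lsc_efun j" "\<And>z. j z \<noteq> -\<infinity>"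
    and j_diag: "\<And>z x. j z \<noteq> \<infinity> \<Longrightarrow> j (z + (x, x)) = j z"
    and \<omega>: "\<And>i. \<omega> i > 0"
    and F_periodic: "\<And>n x i. n \<in> {1..T} \<Longrightarrow> F n (x + \<omega> i *\<^sub>R axis i 1) = F n x"
    and h: "(\<Sum>n=1..T. h n) = 0"
  shows "\<exists>u\<in>X_space T. (\<forall>k\<le>T. norm (fdiff u k) \<le> a) \<and>
    (\<forall>v. energy a T \<Phi> j F h u \<le> energy a T \<Phi> j F h v)"
proof -
  define R where "R = (\<Sum>i\<in>UNIV. \<omega> i) + real (T + 1) * a"
  define K where "K = {u::nat \<Rightarrow> real^'n. \<forall>n. u n \<in> (if n \<le> T + 1 then cball 0 R else {undefined})}"
  define A where "A = {u::nat \<Rightarrow> real^'n. \<forall>k\<le>T. norm (fdiff u k) \<le> a}"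
  define f where "f u = ereal (action T \<Phi> F h u) + j (u 0, u (T + 1))" for u
  have energy: "energy a T \<Phi> j F h u = (if u \<in> A then f u else \<infinity>)" for u
    unfolding A_def mem_Collect_eq f_def by (rule energy_eq) (rule j(2))
  have K_X: "K \<subseteq> X_space T"
  proof
    fix u assume "u \<in> K"
    then have "u n = undefined" if "n \<notin> {0..T+1}" for n
      using that unfolding K_def mem_Collect_eq by (metis atLeastAtMost_iff le0 singletonD)
    then show "u \<in> X_space T"
      by (simp add: X_space_def PiE_iff extensional_def)
  qed
  have R: "0 \<le> R"
    unfolding R_def by (intro add_nonneg_nonneg sum_nonneg mult_nonneg_nonneg a less_imp_le[OF \<omega>]) simp
  have coord: "continuous_on S (\<lambda>u::nat \<Rightarrow> real^'n. u i)" for S i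
    by (rule continuous_on_subset[OF continuous_on_product_coordinates]) simp
  have "closed A"
    unfolding A_def fdiff_def by (intro closed_Collect_all closed_Collect_imp open_Collect_const
        closed_Collect_le continuous_intros coord)
  moreover have "compact K"
    unfolding K_def by (rule compact_pointwise) auto
  ultimately have "compact (K \<inter> A)" by (intro compact_Int_closed)
  moreover have zero: "restrict (\<lambda>_. 0) {0..T+1} \<in> K \<inter> A"
    using R a by (auto simp: K_def A_def fdiff_def)
  moreover have "\<forall>\<^sub>F v in at u within K \<inter> A. c < f v" if u: "u \<in> K \<inter> A" and c: "c < f u" for u c
    unfolding f_def
  proof (rule eventually_less_real_plus_lsc)
    have "continuous_on (K \<inter> A) (action T \<Phi> F h)"
      using \<Phi> F by (rule continuous_on_action) (auto simp: A_def)
    then show "(action T \<Phi> F h \<longlongrightarrow> action T \<Phi> F h u) (at u within K \<inter> A)"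
      using u by (simp add: continuous_on_def)
    show "c < ereal (action T \<Phi> F h u) + j (u 0, u (T + 1))" using c by (simp add: f_def)
    show "j (u 0, u (T + 1)) \<noteq> -\<infinity>" by (rule j(2))
    have "continuous_on (K \<inter> A) (\<lambda>v. (v 0, v (T + 1)))" by (intro continuous_intros coord)
    then have "((\<lambda>v. (v 0, v (T + 1))) \<longlongrightarrow> (u 0, u (T + 1))) (at u within K \<inter> A)"
      using u unfolding continuous_on_def by blast
    then show "\<forall>\<^sub>F v in at u within K \<inter> A. d < j (v 0, v (T + 1))" if "d < j (u 0, u (T + 1))" for d
      using j(1) that unfolding lsc_efun_def filterlim_iff by blast
  qed
  ultimately obtain u where u: "u \<in> K \<inter> A" and min: "\<And>v. v \<in> K \<inter> A \<Longrightarrow> f u \<le> f v"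
    using compact_lsc_attains_min[of "K \<inter> A" f] by (metis empty_iff)
  have "energy a T \<Phi> j F h u \<le> energy a T \<Phi> j F h v" for v
  proof (cases "v \<in> A \<and> j (v 0, v (T + 1)) \<noteq> \<infinity>")
    case True
    \<comment> \<open>The vector of periods that moves \<open>v 0\<close> into the period box.\<close>
    define c :: "real^'n" where "c = (\<Sum>i\<in>UNIV. of_int (- \<lfloor>v 0 $ i / \<omega> i\<rfloor>) *\<^sub>R (\<omega> i *\<^sub>R axis i 1))"
    define v' where "v' n = v n + c" for n
    have diff: "fdiff v' k = fdiff v k" for k by (simp add: v'_def fdiff_def)
    have F_c: "F n (x + c) = F n x" if "n \<in> {1..T}" for n x
      unfolding c_def by (rule period_lattice) (use F_periodic that in auto)
    have "action T \<Phi> F h v' = action T \<Phi> F h v"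
      unfolding v'_def[abs_def] by (rule action_translate[where c = c]) (fact h F_c)+
    moreover have "j (v' 0, v' (T + 1)) = j (v 0, v (T + 1))"
      using j_diag[of "(v 0, v (T + 1))" c] True by (simp add: v'_def)
    ultimately have "f v' = f v" by (simp only: f_def)
    moreover have "v' \<in> A" using True by (simp add: A_def diff)
    ultimately have energy_v: "energy a T \<Phi> j F h (restrict v' {0..T+1}) = energy a T \<Phi> j F h v"
      using True unfolding energy_restrict by (simp add: energy)
    have "norm (v' n) \<le> R" if "n \<le> T + 1" for n
    proof -
      have "norm (v' n) \<le> norm (v' 0) + real n * a"
        by (rule norm_le_of_differences) (use \<open>v' \<in> A\<close> that in \<open>auto simp: A_def\<close>)
      also have "\<dots> \<le> R"
        unfolding R_def
      proof (rule add_mono)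
        show "norm (v' 0) \<le> (\<Sum>i\<in>UNIV. \<omega> i)"
          unfolding v'_def c_def by (rule lattice_translate_into_box[OF \<omega>])
        show "real n * a \<le> real (T + 1) * a"
          using that a by (intro mult_right_mono) auto
      qed
      finally show ?thesis .
    qed
    then have "restrict v' {0..T+1} \<in> K" by (auto simp: K_def)
    moreover have "restrict v' {0..T+1} \<in> A"
      using \<open>v' \<in> A\<close> by (auto simp: A_def fdiff_def)
    ultimately have "f u \<le> f (restrict v' {0..T+1})" by (intro min) simp
    then have "energy a T \<Phi> j F h u \<le> energy a T \<Phi> j F h (restrict v' {0..T+1})"
      using u \<open>restrict v' {0..T+1} \<in> A\<close> by (simp add: energy)
    then show ?thesis by (simp only: energy_v)
  next
    case False
    then have "energy a T \<Phi> j F h v = \<infinity>" by (auto simp: energy f_def)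
    then show ?thesis by simp
  qed
  then show ?thesis using u K_X by (auto simp: A_def)
qed

section \<open>Existence of a solution by energy minimization\<close>

theorem theorem5p3:
  fixes T :: nat and a :: real
    and \<phi> :: "real^'n \<Rightarrow> real^'n" and \<Phi> :: "real^'n \<Rightarrow> real"
    and F :: "nat \<Rightarrow> real^'n \<Rightarrow> real" and gradF :: "nat \<Rightarrow> real^'n \<Rightarrow> real^'n"
    and j :: "(real^'n) \<times> (real^'n) \<Rightarrow> ereal"
    and \<omega> :: "'n \<Rightarrow> real" and h :: "nat \<Rightarrow> real^'n"
  assumes T: "T \<ge> 2" and a: "a > 0"
    and phi_homeo: "\<exists>\<psi>. homeomorphism (ball 0 a) UNIV \<phi> \<psi>"
    and phi_0: "\<phi> 0 = 0"
    and Phi_grad: "\<And>x. x \<in> ball 0 a \<Longrightarrow> GDERIV \<Phi> x :> \<phi> x"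
    and Phi_C1: "continuous_on (ball 0 a) \<phi>"
    and Phi_cont: "continuous_on (cball 0 a) \<Phi>"
    and Phi_strict: "strictly_convex_on (cball 0 a) \<Phi>"
    and Phi_0: "\<Phi> 0 = 0"
    and F_cont: "continuous_on ({1..T} \<times> UNIV) (\<lambda>(n, u). F n u)"
    and F_grad: "\<And>n u. n \<in> {1..T} \<Longrightarrow> GDERIV (F n) u :> gradF n u"
    and gradF_cont: "continuous_on ({1..T} \<times> UNIV) (\<lambda>(n, u). gradF n u)"
    and F_0: "\<And>n. n \<in> {1..T} \<Longrightarrow> F n 0 = 0"
    and j_proper: "proper_fun j" and j_convex: "convex_efun j" and j_lsc: "lsc_efun j"
    and j_0: "j (0, 0) = 0" and j_subdiff_0: "(0, 0) \<in> subdifferential j (0, 0)"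
    and j_diag: "\<And>z \<zeta>. z \<in> edom j \<Longrightarrow> \<zeta> \<in> {(x, x) | x. True} \<Longrightarrow> j (z + \<zeta>) = j z"
    and omega_pos: "\<And>i. \<omega> i > 0"
    and F_periodic: "\<And>n u i. n \<in> {1..T} \<Longrightarrow> F n (u + \<omega> i *\<^sub>R axis i 1) = F n u"
    and h_mean: "mean T h = 0"
  shows "(\<exists>c::real. \<forall>u\<in>X_space T. ereal c \<le> energy a T \<Phi> j F h u) \<and>
         (\<exists>u\<in>Psi_J_dom a T j.
            energy a T \<Phi> j F h u = (INF v\<in>X_space T. energy a T \<Phi> j F h v) \<and>
            is_solution a T \<phi> j gradF h u)"
proof -
  obtain \<psi> where hom: "homeomorphism (ball 0 a) UNIV \<phi> \<psi>" using phi_homeo by blast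
  have conv: "convex_on (cball 0 a) \<Phi>"
    using Phi_strict by (rule strictly_convex_on_imp_convex_on)
  \<comment> \<open>A subgradient zero makes the origin a global minimum of \<open>j\<close>.\<close>
  have j_nonneg: "0 \<le> j z" for z
  proof -
    have "j (0, 0) + ereal (inner (0, 0) (z - (0, 0))) \<le> j z"
      using j_subdiff_0 unfolding subdifferential_def by blast
    moreover have "inner (0, 0) (z - (0, 0)) = 0"
      by (simp add: inner_prod_def)
    ultimately show ?thesis by (simp only: j_0 add_0 flip: zero_ereal_def)
  qed
  have j_not_minf: "j z \<noteq> -\<infinity>" for z using j_nonneg[of z] by auto
  have F_cont': "continuous_on UNIV (F n)" if "n \<in> {1..T}" for n
    using F_grad[OF that] unfolding gderiv_def
    by (intro continuous_at_imp_continuous_on ballI) (rule has_derivative_continuous)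
  have h_sum: "(\<Sum>n=1..T. h n) = 0" using h_mean T by (simp add: mean_def)
  have diag: "j (z + (x, x)) = j z" if "j z \<noteq> \<infinity>" for z x
    using that by (intro j_diag) (auto simp: edom_def less_top)
  have "\<exists>u\<in>X_space T. (\<forall>k\<le>T. norm (fdiff u k) \<le> a) \<and>
      (\<forall>v. energy a T \<Phi> j F h u \<le> energy a T \<Phi> j F h v)"
    by (rule energy_attains_min[where \<omega> = \<omega>])
      (fact less_imp_le[OF a] Phi_cont F_cont' j_lsc j_not_minf diag omega_pos F_periodic h_sum)+
  then obtain u where uX: "u \<in> X_space T" and ua: "\<And>k. k \<le> T \<Longrightarrow> norm (fdiff u k) \<le> a"
    and min: "\<And>v. energy a T \<Phi> j F h u \<le> energy a T \<Phi> j F h v"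
    by auto
  have energy_u: "energy a T \<Phi> j F h u = ereal (action T \<Phi> F h u) + j (u 0, u (T + 1))"
    using ua j_not_minf by (subst energy_eq) auto
  have "energy a T \<Phi> j F h (\<lambda>_. 0) = ereal (action T \<Phi> F h (\<lambda>_. 0))"
    using a j_0 by (subst energy_eq) (auto simp: fdiff_def)
  with min[of "\<lambda>_. 0"] have ju_fin: "j (u 0, u (T + 1)) \<noteq> \<infinity>"
    by (auto simp: energy_u)
  then obtain ju where ju: "j (u 0, u (T + 1)) = ereal ju"
    using j_not_minf by (cases "j (u 0, u (T + 1))") auto
  have min': "ereal (action T \<Phi> F h u) + j (u 0, u (T + 1)) \<le>
      ereal (action T \<Phi> F h v) + j (v 0, v (T + 1))" if "\<And>k. k \<le> T \<Longrightarrow> norm (fdiff v k) \<le> a" for v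
    using min[of v] that j_not_minf by (simp add: energy_u energy_eq)
  have interior: "norm (fdiff u k) < a" if "k \<le> T" for k
    by (rule minimizer_interior[where j = j and u = u])
      (fact a hom Phi_grad Phi_cont conv Phi_0 phi_0 F_grad j_convex j_0 j_nonneg ju_fin ua min' that)+
  have var: "ju + (\<Sum>n=1..T. inner (gradF n (u n) + h n) (w n))
      \<le> jw + (\<Sum>k\<le>T. inner (\<phi> (fdiff u k)) (fdiff w k))"
    if "j (u 0 + w 0, u (T + 1) + w (T + 1)) = ereal jw" for w jw
    by (rule minimizer_variational_inequality[where j = j and u = u])
      (fact Phi_grad F_grad j_convex ju interior min' that)+
  have T1: "T \<ge> 1" using T by simp
  have eqs: "\<phi> (fdiff u (n - 1)) - \<phi> (fdiff u n) = gradF n (u n) + h n" if "n \<in> {1..T}" for n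
    by (rule variational_inequality_imp_solution(1)[where j = j and u = u])
      (fact T1 ju j_not_minf var that)+
  have bc: "(\<phi> (fdiff u 0), - \<phi> (fdiff u T)) \<in> subdifferential j (u 0, u (T + 1))"
    by (rule variational_inequality_imp_solution(2)[where j = j and u = u])
      (fact T1 ju j_not_minf var)+
  have "- fdiff (\<lambda>k. \<phi> (fdiff u k)) (n - 1) = gradF n (u n) + h n" if "n \<in> {1..T}" for n
    using eqs[OF that] that by (simp add: fdiff_def)
  then have "is_solution a T \<phi> j gradF h u"
    using uX interior bc unfolding is_solution_def fdiff_supnorm_less_iff by auto
  moreover have "u \<in> Psi_J_dom a T j"
    using uX ua ju by (simp add: Psi_J_dom_def fdiff_supnorm_le_iff edom_def)
  moreover have "energy a T \<Phi> j F h u = (INF v\<in>X_space T. energy a T \<Phi> j F h v)"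
    using uX min by (intro antisym INF_greatest INF_lower) auto
  moreover have "ereal (action T \<Phi> F h u + ju) \<le> energy a T \<Phi> j F h v" for v
    using min[of v] unfolding energy_u ju by simp
  ultimately show ?thesis by (intro conjI exI[of _ "action T \<Phi> F h u + ju"] bexI[of _ u]) auto
qed

end
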